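(* Let $\mathbf i=(i_1,\dots,i_\ell)$ be a word in $\{1,\dots,n-1\}$, $\boldsymbol\kappa\in\mathbb Z_{\ge0}^\ell$, $\mathbf d=(d_1,\dots,d_n)\in\mathbb Z_{\ge0}^n$. For each colour $j<n$ write $0<t_{j,1}<\cdots<t_{j,m_j}$ for the positions $t$ with $i_t=j$, put $t_{j,m_j+1}=\ell+1$, and set $$I_{j,k}(\boldsymbol\kappa)=\sum_{\substack{t_{j,k}<s<t_{j,k+1}\\ i_s=j-1}}\kappa_s\qquad(1\le k\le m_j).$$ The creation-state graph $\mathfrak C(\mathbf i,\boldsymbol\kappa,\mathbf d)$ is balanced exactly when, for every occurring colour $j<n$, $$I_{j,k}(\boldsymbol\kappa)\ge\kappa_{t_{j,k}}\quad(1\le k<m_j),\qquad(1)$$ $$d_j+I_{j,m_j}(\boldsymbol\kappa)\ge\kappa_{t_{j,m_j}}.\qquad(2)$$ For given $\mathbf i,\boldsymbol\kappa$, a completion by terminal root edges (i.e. some $\mathbf d\in\mathbb Z_{\ge0}^n$ making the graph balanced) exists if and only if the inequalities (1) hold for all occurring colours. When they do, the componentwise least completion is $$d_j^{\min}(\boldsymbol\kappa)=\max\{0,\kappa_{t_{j,m_j}}-I_{j,m_j}(\boldsymbol\kappa)\}$$ for occurring colours $j$, and $d_j^{\min}=0$ for the remaining ranks, including $j=n$.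
   Context: **Creation-state graph.** For $1\le j\le n$ put $T_j=\{0\}\cup\{t\in[\ell]:i_t=j\}$, $\tau_j(t)=\max(T_j\cap\{0,\dots,t\})$, $\lambda_j=\tau_j(\ell)$. The rooted directed multigraph $\mathfrak C(\mathbf i,\boldsymbol\kappa,\mathbf d)$ has vertex set $\{0\}\sqcup\{v_{j,r}:1\le j\le n,\ r\in T_j\}$. For each $t\in[\ell]$ it has $\kappa_t$ parallel copies of the ordinary edge $v_{i_t,t}\to v_{i_t+1,\tau_{i_t+1}(t-1)}$, and for each $j$ it has $d_j$ root edges $0\to v_{j,\lambda_j}$. The graph is balanced if, at every vertex other than the root $0$, the total incoming multiplicity (including root edges) is at least the outgoing ordinary multiplicity. *)

theory Defs
  imports "Graph_Theory.Digraph"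
begin

text \<open>
  Words and integer vectors are 1-based: a word of length \<open>l\<close> is a function \<open>w\<close> on \<open>nat\<close> of
  which only the values on \<open>{1..l}\<close> matter; likewise a multiplicity vector \<open>\<kappa>\<close> on \<open>{1..l}\<close>
  and a vector \<open>d\<close> on \<open>{1..n}\<close>.
\<close>

definition positions :: "nat \<Rightarrow> (nat \<Rightarrow> nat) \<Rightarrow> nat \<Rightarrow> nat set" where
  "positions l w j = {t \<in> {1..l}. w t = j}"

definition states :: "nat \<Rightarrow> (nat \<Rightarrow> nat) \<Rightarrow> nat \<Rightarrow> nat set" where
  "states l w j = insert 0 (positions l w j)"

definition last_state :: "nat \<Rightarrow> (nat \<Rightarrow> nat) \<Rightarrow> nat \<Rightarrow> nat \<Rightarrow> nat" where
  "last_state l w j t = Max (states l w j \<inter> {0..t})"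

definition final_state :: "nat \<Rightarrow> (nat \<Rightarrow> nat) \<Rightarrow> nat \<Rightarrow> nat" where
  "final_state l w j = last_state l w j l"

datatype vertex = Root | State nat nat

text \<open>The last argument of an edge numbers the parallel copies.\<close>

datatype edge = is_ordinary: Ordinary nat nat | Root_Edge nat nat

fun edge_source :: "(nat \<Rightarrow> nat) \<Rightarrow> edge \<Rightarrow> vertex" where
  "edge_source w (Ordinary t c) = State (w t) t"
| "edge_source w (Root_Edge j c) = Root"

fun edge_target :: "nat \<Rightarrow> (nat \<Rightarrow> nat) \<Rightarrow> edge \<Rightarrow> vertex" where
  "edge_target l w (Ordinary t c) = State (w t + 1) (last_state l w (w t + 1) (t - 1))"
| "edge_target l w (Root_Edge j c) = State j (final_state l w j)"

definition creation_state_graph ::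
  "nat \<Rightarrow> nat \<Rightarrow> (nat \<Rightarrow> nat) \<Rightarrow> (nat \<Rightarrow> nat) \<Rightarrow> (nat \<Rightarrow> nat) \<Rightarrow> (vertex, edge) pre_digraph" where
  "creation_state_graph n l w \<kappa> d =
    \<lparr> verts = insert Root {State j r | j r. j \<in> {1..n} \<and> r \<in> states l w j},
      arcs = {Ordinary t c | t c. t \<in> {1..l} \<and> c < \<kappa> t} \<union>
             {Root_Edge j c | j c. j \<in> {1..n} \<and> c < d j},
      tail = edge_source w,
      head = edge_target l w \<rparr>"

definition balanced :: "(vertex, edge) pre_digraph \<Rightarrow> bool" where
  "balanced G \<longleftrightarrow>
    (\<forall>v \<in> verts G - {Root}. card {e \<in> out_arcs G v. is_ordinary e} \<le> in_degree G v)"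

lemma fin_digraph_creation_state_graph:
  assumes "\<forall>t\<in>{1..l}. w t \<in> {1..<n}"
  shows "fin_digraph (creation_state_graph n l w \<kappa> d)"
proof -
  have last: "last_state l w j t \<in> states l w j" for j t
  proof -
    have "last_state l w j t \<in> states l w j \<inter> {0..t}"
      unfolding last_state_def by (rule Max_in) (auto simp: states_def)
    then show ?thesis by simp
  qed
  interpret wf_digraph "creation_state_graph n l w \<kappa> d"
  proof
    fix e assume e: "e \<in> arcs (creation_state_graph n l w \<kappa> d)"
    show "tail (creation_state_graph n l w \<kappa> d) e \<in> verts (creation_state_graph n l w \<kappa> d)"
    proof (cases e)
      case (Ordinary t c)
      with e have "t \<in> {1..l}" by (simp add: creation_state_graph_def)
      with assms have "w t \<in> {1..<n}" "t \<in> states l w (w t)"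
        by (auto simp: states_def positions_def)
      with Ordinary show ?thesis by (simp add: creation_state_graph_def)
    qed (simp add: creation_state_graph_def)
    show "head (creation_state_graph n l w \<kappa> d) e \<in> verts (creation_state_graph n l w \<kappa> d)"
    proof (cases e)
      case (Ordinary t c)
      with e have "t \<in> {1..l}" by (simp add: creation_state_graph_def)
      with assms have "w t \<in> {1..<n}" by blast
      with Ordinary show ?thesis by (simp add: creation_state_graph_def last)
    next
      case (Root_Edge j c)
      with e show ?thesis by (simp add: creation_state_graph_def final_state_def last)
    qed
  qed
  have "verts (creation_state_graph n l w \<kappa> d)
      = insert Root (\<Union>j\<in>{1..n}. State j ` states l w j)"
    by (auto simp: creation_state_graph_def)
  moreover have "arcs (creation_state_graph n l w \<kappa> d)
      = (\<Union>t\<in>{1..l}. Ordinary t ` {..<\<kappa> t}) \<union> (\<Union>j\<in>{1..n}. Root_Edge j ` {..<d j})"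
    by (auto simp: creation_state_graph_def)
  ultimately show ?thesis
    by (intro fin_digraphI) (auto simp: states_def positions_def)
qed

definition occurring :: "nat \<Rightarrow> (nat \<Rightarrow> nat) \<Rightarrow> nat \<Rightarrow> bool" where
  "occurring l w j \<longleftrightarrow> positions l w j \<noteq> {}"

definition num_positions :: "nat \<Rightarrow> (nat \<Rightarrow> nat) \<Rightarrow> nat \<Rightarrow> nat" where
  "num_positions l w j = card (positions l w j)"

text \<open>
  For \<open>k\<close> from 1 to \<open>num_positions l w j + 1\<close>: the \<open>k\<close>-th position of the letter \<open>j\<close>,
  with the sentinel \<open>l + 1\<close> following the last one.
\<close>

definition pos :: "nat \<Rightarrow> (nat \<Rightarrow> nat) \<Rightarrow> nat \<Rightarrow> nat \<Rightarrow> nat" where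
  "pos l w j k = (sorted_list_of_set (positions l w j) @ [l + 1]) ! (k - 1)"

definition inflow :: "nat \<Rightarrow> (nat \<Rightarrow> nat) \<Rightarrow> (nat \<Rightarrow> nat) \<Rightarrow> nat \<Rightarrow> nat \<Rightarrow> nat" where
  "inflow l w \<kappa> j k =
    (\<Sum>s | pos l w j k < s \<and> s < pos l w j (k + 1) \<and> w s + 1 = j. \<kappa> s)"

definition interior_inequalities :: "nat \<Rightarrow> (nat \<Rightarrow> nat) \<Rightarrow> (nat \<Rightarrow> nat) \<Rightarrow> nat \<Rightarrow> bool" where
  "interior_inequalities l w \<kappa> j \<longleftrightarrow>
    (\<forall>k. 1 \<le> k \<and> k < num_positions l w j \<longrightarrow> inflow l w \<kappa> j k \<ge> \<kappa> (pos l w j k))"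

definition terminal_inequality ::
  "nat \<Rightarrow> (nat \<Rightarrow> nat) \<Rightarrow> (nat \<Rightarrow> nat) \<Rightarrow> (nat \<Rightarrow> nat) \<Rightarrow> nat \<Rightarrow> bool" where
  "terminal_inequality l w \<kappa> d j \<longleftrightarrow>
    (let m = num_positions l w j in d j + inflow l w \<kappa> j m \<ge> \<kappa> (pos l w j m))"

definition min_completion :: "nat \<Rightarrow> nat \<Rightarrow> (nat \<Rightarrow> nat) \<Rightarrow> (nat \<Rightarrow> nat) \<Rightarrow> nat \<Rightarrow> nat" where
  "min_completion n l w \<kappa> j =
    (if j < n \<and> occurring l w j
     then let m = num_positions l w j
          in nat (max 0 (int (\<kappa> (pos l w j m)) - int (inflow l w \<kappa> j m)))
     else 0)"

definition is_completion ::
  "nat \<Rightarrow> nat \<Rightarrow> (nat \<Rightarrow> nat) \<Rightarrow> (nat \<Rightarrow> nat) \<Rightarrow> (nat \<Rightarrow> nat) \<Rightarrow> bool" where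
  "is_completion n l w \<kappa> d \<longleftrightarrow> balanced (creation_state_graph n l w \<kappa> d)"

definition is_least_completion ::
  "nat \<Rightarrow> nat \<Rightarrow> (nat \<Rightarrow> nat) \<Rightarrow> (nat \<Rightarrow> nat) \<Rightarrow> (nat \<Rightarrow> nat) \<Rightarrow> bool" where
  "is_least_completion n l w \<kappa> d \<longleftrightarrow>
    is_completion n l w \<kappa> d \<and>
    (\<forall>d'. is_completion n l w \<kappa> d' \<longrightarrow> (\<forall>j\<in>{1..n}. d j \<le> d' j))"

end

theory Submission
  imports Defs
begin

text \<open>
  Balance is a condition at each state separately, so it suffices to compute both sides at
  \<open>State j r\<close>. An initial state \<open>r = 0\<close> has no outgoing ordinary edge, so only the states
  \<open>r = pos l w j k\<close> created by an occurrence of \<open>j\<close> matter; in particular the rank \<open>n\<close> imposes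
  no condition. Such a state emits exactly the \<open>\<kappa> r\<close> edges of position \<open>r\<close>. It is the current
  state of colour \<open>j\<close> exactly from its creation until the next occurrence of \<open>j\<close>
  (\<open>last_state_eq_pos_iff\<close>), and the edges created in that window by the colour \<open>j - 1\<close> are the
  ones that end in it, so their number is the inflow. The root edges of colour \<open>j\<close> enter only
  its final state, the one with \<open>k = num_positions l w j\<close>. Hence balance at the states of
  colour \<open>j\<close> is the conjunction of the interior inequalities and the terminal one
  (\<open>balanced_iff_inequalities\<close>).

  The vector \<open>d\<close> enters only through the terminal inequalities, one for each coordinate, and each
  is a lower bound \<open>min_completion n l w \<kappa> j \<le> d j\<close>. Such a system is always solvable, and the
  bounds themselves form its least solution; so existence and minimality follow together.
\<close>

section \<open>Occurrences of a letter\<close>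

lemma finite_positions [simp]: "finite (positions l w j)"
  by (simp add: positions_def)

lemma pos_eq_nth:
  assumes "1 \<le> k" "k \<le> num_positions l w j"
  shows "pos l w j k = sorted_list_of_set (positions l w j) ! (k - 1)"
proof -
  have "k - 1 < card (positions l w j)"
    using assms by (simp add: num_positions_def)
  then show ?thesis by (simp add: pos_def nth_append)
qed

lemma pos_sentinel: "pos l w j (Suc (num_positions l w j)) = Suc l"
  by (simp add: pos_def nth_append num_positions_def)

lemma positions_eq_pos_image: "positions l w j = pos l w j ` {1..num_positions l w j}"
proof -
  let ?xs = "sorted_list_of_set (positions l w j)"
  have "positions l w j = set ?xs" by simp
  also have "\<dots> = (\<lambda>i. ?xs ! i) ` {..<num_positions l w j}"
    by (auto simp: set_conv_nth num_positions_def)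
  also have "{..<num_positions l w j} = (\<lambda>k. k - 1) ` {1..num_positions l w j}"
    by (force simp: image_iff intro: bexI[where x = "Suc _"])
  also have "(\<lambda>i. ?xs ! i) ` (\<lambda>k. k - 1) ` {1..num_positions l w j}
      = pos l w j ` {1..num_positions l w j}"
    unfolding image_image by (intro image_cong) (auto simp: pos_eq_nth)
  finally show ?thesis .
qed

lemma pos_in_positions:
  "1 \<le> k \<Longrightarrow> k \<le> num_positions l w j \<Longrightarrow> pos l w j k \<in> positions l w j"
  by (simp add: positions_eq_pos_image)

lemma pos_strict_mono:
  assumes "1 \<le> k" "k < k'" "k' \<le> Suc (num_positions l w j)"
  shows "pos l w j k < pos l w j k'"
proof (cases "k' = Suc (num_positions l w j)")
  case True
  have "pos l w j k \<le> l"
    using pos_in_positions[of k l w j] assms by (auto simp: positions_def)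
  then show ?thesis by (simp add: True pos_sentinel)
next
  case False
  have "sorted_list_of_set (positions l w j) ! (k - 1)
      < sorted_list_of_set (positions l w j) ! (k' - 1)"
  proof (rule sorted_wrt_nth_less[OF strict_sorted_list_of_set])
    show "k - 1 < k' - 1" using assms by linarith
    show "k' - 1 < length (sorted_list_of_set (positions l w j))"
      using assms False by (simp add: num_positions_def)
  qed
  with assms False show ?thesis by (simp add: pos_eq_nth)
qed

text \<open>
  The current state only changes at an occurrence of \<open>j\<close>. The bound \<open>t \<le> l\<close> makes the sentinel
  \<open>l + 1\<close> act as a next occurrence that is never reached, so the last occurrence is not special.
\<close>

lemma last_state_eq_pos_iff:
  assumes k: "1 \<le> k" "k \<le> num_positions l w j" and "t \<le> l"
  shows "last_state l w j t = pos l w j k \<longleftrightarrow> pos l w j k \<le> t \<and> t < pos l w j (Suc k)"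
proof
  have fin: "finite (states l w j \<inter> {0..t})" by simp
  {
    assume eq: "last_state l w j t = pos l w j k"
    have "last_state l w j t \<in> states l w j \<inter> {0..t}"
      unfolding last_state_def by (rule Max_in) (auto simp: states_def)
    then have "pos l w j k \<le> t" by (simp add: eq)
    moreover have "t < pos l w j (Suc k)"
    proof (rule ccontr)
      assume "\<not> t < pos l w j (Suc k)"
      then have le: "pos l w j (Suc k) \<le> t" by simp
      with \<open>t \<le> l\<close> have "k \<noteq> num_positions l w j"
        using pos_sentinel[of l w j] by auto
      with k have "pos l w j (Suc k) \<in> positions l w j"
        by (intro pos_in_positions) auto
      then have "pos l w j (Suc k) \<le> last_state l w j t"
        unfolding last_state_def using le by (intro Max_ge fin) (simp add: states_def)
      with eq pos_strict_mono[of k "Suc k" l w j] k show False by simp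
    qed
    ultimately show "pos l w j k \<le> t \<and> t < pos l w j (Suc k)" ..
  next
    assume window: "pos l w j k \<le> t \<and> t < pos l w j (Suc k)"
    show "last_state l w j t = pos l w j k"
      unfolding last_state_def
    proof (rule Max_eqI[OF fin])
      fix r assume r: "r \<in> states l w j \<inter> {0..t}"
      show "r \<le> pos l w j k"
      proof (cases "r = 0")
        case False
        with r obtain k' where k': "1 \<le> k'" "k' \<le> num_positions l w j" "r = pos l w j k'"
          by (auto simp: states_def positions_eq_pos_image)
        have "k' \<le> k"
        proof (rule ccontr)
          assume "\<not> k' \<le> k"
          then have "pos l w j (Suc k) \<le> pos l w j k'"
            using pos_strict_mono[of "Suc k" k' l w j] k' by (cases "k' = Suc k") auto
          with window r k' show False by simp
        qed
        with k k' show ?thesis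
          using pos_strict_mono[of k' k l w j] by (cases "k' = k") auto
      qed simp
    next
      show "pos l w j k \<in> states l w j \<inter> {0..t}"
        using window pos_in_positions[OF k] by (simp add: states_def)
    qed
  }
qed

lemma final_state_eq_pos_iff:
  assumes k: "1 \<le> k" "k \<le> num_positions l w j"
  shows "final_state l w j = pos l w j k \<longleftrightarrow> k = num_positions l w j"
proof -
  have in_range: "pos l w j i \<le> l" if "1 \<le> i" "i \<le> num_positions l w j" for i
    using pos_in_positions[OF that] by (simp add: positions_def)
  have "l < pos l w j (Suc k) \<longleftrightarrow> k = num_positions l w j"
    using in_range[of "Suc k"] k pos_sentinel[of l w j]
    by (cases "k = num_positions l w j") auto
  then show ?thesis
    using in_range[OF k] by (simp add: final_state_def last_state_eq_pos_iff[OF k])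
qed

section \<open>Degrees in the creation-state graph\<close>

lemma card_ordinary_edges:
  assumes "finite A"
  shows "card {Ordinary t c | t c. t \<in> A \<and> c < \<kappa> t} = sum \<kappa> A"
proof -
  have "{Ordinary t c | t c. t \<in> A \<and> c < \<kappa> t}
      = (\<lambda>(t, c). Ordinary t c) ` (SIGMA t:A. {..<\<kappa> t})"
    by force
  moreover have "inj_on (\<lambda>(t, c). Ordinary t c) (SIGMA t:A. {..<\<kappa> t})"
    by (auto simp: inj_on_def)
  ultimately show ?thesis
    using assms by (simp add: card_image)
qed

lemma out_ordinary_degree:
  assumes "r \<in> states l w j"
  shows "card {e \<in> out_arcs (creation_state_graph n l w \<kappa> d) (State j r). is_ordinary e}
    = (if r = 0 then 0 else \<kappa> r)"
proof -
  have "{e \<in> out_arcs (creation_state_graph n l w \<kappa> d) (State j r). is_ordinary e}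
      = {Ordinary t c | t c. t \<in> (if r = 0 then {} else {r}) \<and> c < \<kappa> t}"
    using assms
    by (auto simp: creation_state_graph_def out_arcs_def states_def positions_def)
  then show ?thesis
    by (simp add: card_ordinary_edges del: mem_Collect_eq)
qed

lemma in_degree_state:
  assumes "j \<in> {1..n}"
  shows "in_degree (creation_state_graph n l w \<kappa> d) (State j r)
    = (\<Sum>t | t \<in> {1..l} \<and> w t + 1 = j \<and> last_state l w j (t - 1) = r. \<kappa> t)
      + (if final_state l w j = r then d j else 0)"
proof -
  let ?S = "{t \<in> {1..l}. w t + 1 = j \<and> last_state l w j (t - 1) = r}"
  let ?O = "{Ordinary t c | t c. t \<in> ?S \<and> c < \<kappa> t}"
  let ?R = "Root_Edge j ` {..<if final_state l w j = r then d j else 0}"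
  have "in_arcs (creation_state_graph n l w \<kappa> d) (State j r) = ?O \<union> ?R"
    using assms by (auto simp: creation_state_graph_def in_arcs_def)
  moreover have "finite ?O"
    by (rule finite_subset[of _ "(\<lambda>(t, c). Ordinary t c) ` (SIGMA t:?S. {..<\<kappa> t})"]) force+
  moreover have "?O \<inter> ?R = {}" by auto
  moreover have "card ?O = sum \<kappa> ?S" by (rule card_ordinary_edges) simp
  moreover have "card ?R = (if final_state l w j = r then d j else 0)"
    by (subst card_image) (auto simp: inj_on_def)
  ultimately show ?thesis
    by (simp only: in_degree_def card_Un_disjoint finite_imageI finite_lessThan)
qed

text \<open>
  The window of \<open>last_state_eq_pos_iff\<close>, shifted by one because an edge of position \<open>s\<close> ends in
  the state current at time \<open>s - 1\<close>, is \<open>pos k < s \<le> pos (k + 1)\<close>. Its right end carries the letter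
  \<open>j\<close>, or is the sentinel, so no edge of colour \<open>j - 1\<close> is lost in the strict inequality of the
  inflow.
\<close>

lemma in_degree_pos:
  assumes j: "j \<in> {1..n}" and k: "1 \<le> k" "k \<le> num_positions l w j"
  shows "in_degree (creation_state_graph n l w \<kappa> d) (State j (pos l w j k))
    = inflow l w \<kappa> j k + (if k = num_positions l w j then d j else 0)"
proof -
  have next_pos: "pos l w j (Suc k) = Suc l \<or> pos l w j (Suc k) \<in> positions l w j"
    using k pos_sentinel[of l w j] pos_in_positions[of "Suc k" l w j]
    by (cases "k = num_positions l w j") auto
  have "{s. s \<in> {1..l} \<and> w s + 1 = j \<and> last_state l w j (s - 1) = pos l w j k}
      = {s. pos l w j k < s \<and> s < pos l w j (k + 1) \<and> w s + 1 = j}" (is "?L = ?R")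
  proof (intro set_eqI iffI)
    fix s assume "s \<in> ?L"
    then have s: "1 \<le> s" "s \<le> l" "w s + 1 = j" "last_state l w j (s - 1) = pos l w j k"
      by auto
    then have "pos l w j k \<le> s - 1" "s - 1 < pos l w j (Suc k)"
      using last_state_eq_pos_iff[OF k, of "s - 1"] by auto
    moreover have "s \<noteq> pos l w j (Suc k)"
      using s next_pos by (auto simp: positions_def)
    ultimately show "s \<in> ?R" using s by auto
  next
    fix s assume s: "s \<in> ?R"
    with next_pos have "s \<le> l" by (auto simp: positions_def)
    with s show "s \<in> ?L"
      using last_state_eq_pos_iff[OF k, of "s - 1"] by auto
  qed
  then show ?thesis
    by (simp only: in_degree_state[OF j] final_state_eq_pos_iff[OF k] inflow_def)
qed

section \<open>Balance and completions\<close>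

lemma balanced_iff_inequalities:
  assumes w: "\<forall>t\<in>{1..l}. w t \<in> {1..<n}"
  shows "balanced (creation_state_graph n l w \<kappa> d) \<longleftrightarrow>
    (\<forall>j\<in>{1..<n}. occurring l w j \<longrightarrow>
       interior_inequalities l w \<kappa> j \<and> terminal_inequality l w \<kappa> d j)"
proof -
  let ?G = "creation_state_graph n l w \<kappa> d"
  let ?ok = "\<lambda>j k. \<kappa> (pos l w j k)
    \<le> inflow l w \<kappa> j k + (if k = num_positions l w j then d j else 0)"
  have last_rank: "positions l w n = {}"
    using w by (auto simp: positions_def)
  have local: "card {e \<in> out_arcs ?G (State j (pos l w j k)). is_ordinary e}
        \<le> in_degree ?G (State j (pos l w j k)) \<longleftrightarrow> ?ok j k"
    if "j \<in> {1..n}" "1 \<le> k" "k \<le> num_positions l w j" for j k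
  proof -
    have "pos l w j k \<in> positions l w j"
      using that by (intro pos_in_positions)
    then have "pos l w j k \<in> states l w j" "pos l w j k \<noteq> 0"
      by (auto simp: states_def positions_def)
    then show ?thesis
      by (simp only: out_ordinary_degree in_degree_pos[OF that] if_False)
  qed
  have "balanced ?G \<longleftrightarrow> (\<forall>j\<in>{1..n}. \<forall>r\<in>states l w j.
      card {e \<in> out_arcs ?G (State j r). is_ordinary e} \<le> in_degree ?G (State j r))"
    unfolding balanced_def by (auto simp: creation_state_graph_def)
  also have "\<dots> \<longleftrightarrow> (\<forall>j\<in>{1..n}. \<forall>r\<in>positions l w j.
      card {e \<in> out_arcs ?G (State j r). is_ordinary e} \<le> in_degree ?G (State j r))"
    using out_ordinary_degree[of 0] by (auto simp: states_def)
  also have "\<dots> \<longleftrightarrow> (\<forall>j\<in>{1..n}. \<forall>k\<in>{1..num_positions l w j}. ?ok j k)"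
    using local by (simp add: positions_eq_pos_image)
  also have "\<dots> \<longleftrightarrow> (\<forall>j\<in>{1..<n}. \<forall>k\<in>{1..num_positions l w j}. ?ok j k)"
    using last_rank by (auto simp: num_positions_def less_le)
  also have "\<dots> \<longleftrightarrow> (\<forall>j\<in>{1..<n}. occurring l w j \<longrightarrow>
       interior_inequalities l w \<kappa> j \<and> terminal_inequality l w \<kappa> d j)"
  proof (intro ball_cong refl)
    fix j
    have occ: "occurring l w j \<longleftrightarrow> 1 \<le> num_positions l w j"
      by (simp add: occurring_def num_positions_def Suc_le_eq card_gt_0_iff)
    have "(\<forall>k\<in>{1..m}. P k) \<longleftrightarrow> (1 \<le> m \<longrightarrow> (\<forall>k. 1 \<le> k \<and> k < m \<longrightarrow> P k) \<and> P m)"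
      for P :: "nat \<Rightarrow> bool" and m
      by (auto simp: le_less)
    from this[of "num_positions l w j" "?ok j"]
    show "(\<forall>k\<in>{1..num_positions l w j}. ?ok j k) \<longleftrightarrow> (occurring l w j \<longrightarrow>
       interior_inequalities l w \<kappa> j \<and> terminal_inequality l w \<kappa> d j)"
      unfolding occ interior_inequalities_def terminal_inequality_def Let_def
      by (auto simp: add.commute)
  qed
  finally show ?thesis .
qed

lemma terminal_inequality_iff_min_completion_le:
  assumes "j < n" "occurring l w j"
  shows "terminal_inequality l w \<kappa> d j \<longleftrightarrow> min_completion n l w \<kappa> j \<le> d j"
  using assms by (auto simp: terminal_inequality_def min_completion_def Let_def)

theorem propositionB1:
  fixes n l :: nat and w \<kappa> :: "nat \<Rightarrow> nat"
  assumes "\<forall>t\<in>{1..l}. w t \<in> {1..<n}"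
  shows "(\<forall>d :: nat \<Rightarrow> nat.
            balanced (creation_state_graph n l w \<kappa> d) \<longleftrightarrow>
              (\<forall>j\<in>{1..<n}. occurring l w j \<longrightarrow>
                 interior_inequalities l w \<kappa> j \<and> terminal_inequality l w \<kappa> d j)) \<and>
         ((\<exists>d :: nat \<Rightarrow> nat. is_completion n l w \<kappa> d) \<longleftrightarrow>
              (\<forall>j\<in>{1..<n}. occurring l w j \<longrightarrow> interior_inequalities l w \<kappa> j)) \<and>
         ((\<forall>j\<in>{1..<n}. occurring l w j \<longrightarrow> interior_inequalities l w \<kappa> j) \<longrightarrow>
              is_least_completion n l w \<kappa> (min_completion n l w \<kappa>))"
proof -
  let ?interior = "\<forall>j\<in>{1..<n}. occurring l w j \<longrightarrow> interior_inequalities l w \<kappa> j"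
  let ?min = "min_completion n l w \<kappa>"
  note balanced = balanced_iff_inequalities[OF assms]
  have completion: "is_completion n l w \<kappa> d \<longleftrightarrow> ?interior \<and> (\<forall>j\<in>{1..n}. ?min j \<le> d j)" for d
  proof -
    have "is_completion n l w \<kappa> d \<longleftrightarrow>
        ?interior \<and> (\<forall>j\<in>{1..<n}. occurring l w j \<longrightarrow> ?min j \<le> d j)"
      unfolding is_completion_def balanced
      using terminal_inequality_iff_min_completion_le[of _ n l w \<kappa> d] by auto
    also have "(\<forall>j\<in>{1..<n}. occurring l w j \<longrightarrow> ?min j \<le> d j) \<longleftrightarrow> (\<forall>j\<in>{1..n}. ?min j \<le> d j)"
    proof -
      have "?min j = 0" if "\<not> (j < n \<and> occurring l w j)" for j
        using that unfolding min_completion_def by (rule if_not_P)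
      then show ?thesis
        by (metis atLeastAtMost_iff atLeastLessThan_iff le0 less_imp_le)
    qed
    finally show ?thesis .
  qed
  show ?thesis
  proof (intro conjI allI impI)
    show "(\<exists>d. is_completion n l w \<kappa> d) \<longleftrightarrow> ?interior"
      using completion by blast
    show "is_least_completion n l w \<kappa> ?min" if ?interior
      using that by (simp add: is_least_completion_def completion)
  qed (rule balanced)
qed

end
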